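(* Let $P,Q$ be proper upward monotone quantifiers on a nonempty set $D$, and assume that $P$ dominates $Q$. Then: (1) either $P^d$ or $Q$ is a filter; (2) for every infinite regular cardinal $\kappa$, either $P^d$ or $Q$ is $\kappa$-chain-complete.
   Context: A (unary) quantifier on a nonempty set $D$ is a family $Q\subseteq\mathcal P(D)$. It is upward monotone if $A\in Q$ and $A\subseteq B\subseteq D$ imply $B\in Q$; it is proper if $\varnothing\notin Q$ and $D\in Q$. A filter is a proper upward monotone quantifier closed under finite intersections. For an infinite cardinal $\kappa$, $Q$ is $\kappa$-chain-complete if $\bigcap_{\alpha<\kappa}X_\alpha\in Q$ for every descending chain $(X_\alpha)_{\alpha<\kappa}$ in $Q$ (i.e. $X_\beta\subseteq X_\alpha$ whenever $\alpha\leq\beta<\kappa$). The dual of $Q$ is $Q^d=\{A\subseteq D:D\setminus A\notin Q\}$. For $R\subseteq D^2$ put $R_x=\{y\in D:(x,y)\in R\}$ and $R^{-1}=\{(y,x):(x,y)\in R\}$. The iteration is $P\cdot Q=\{R\subseteq D^2:\{x\in D:R_x\in Q\}\in P\}$. $P$ dominates $Q$ if for every $R\subseteq D^2$, $R\in P\cdot Q$ implies $R^{-1}\in Q\cdot P$. "Either ... or" is inclusive. *)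

theory Defs
  imports Main
begin

definition quantifier_on :: "'a set \<Rightarrow> 'a set set \<Rightarrow> bool" where
  "quantifier_on D Q \<longleftrightarrow> Q \<subseteq> Pow D"

definition upward_monotone :: "'a set \<Rightarrow> 'a set set \<Rightarrow> bool" where
  "upward_monotone D Q \<longleftrightarrow> (\<forall>A B. A \<in> Q \<and> A \<subseteq> B \<and> B \<subseteq> D \<longrightarrow> B \<in> Q)"

definition proper_quantifier :: "'a set \<Rightarrow> 'a set set \<Rightarrow> bool" where
  "proper_quantifier D Q \<longleftrightarrow> {} \<notin> Q \<and> D \<in> Q"

text \<open>The empty intersection, read as \<open>D\<close>, is covered by properness.\<close>

definition filter_quantifier :: "'a set \<Rightarrow> 'a set set \<Rightarrow> bool" where
  "filter_quantifier D Q \<longleftrightarrow>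
     quantifier_on D Q \<and> upward_monotone D Q \<and> proper_quantifier D Q \<and>
     (\<forall>F. finite F \<and> F \<noteq> {} \<and> F \<subseteq> Q \<longrightarrow> \<Inter>F \<in> Q)"

text \<open>
  A cardinal \<open>\<kappa>\<close> is a cardinal order in the sense of the library, i.e. a minimal well-order
  on \<open>Field \<kappa>\<close>. The ordinals below \<open>\<kappa>\<close> are the elements of \<open>Field \<kappa>\<close>, and
  \<open>(\<alpha>, \<beta>) \<in> \<kappa>\<close> means \<open>\<alpha> \<le> \<beta>\<close>.
\<close>

definition chain_complete :: "'k rel \<Rightarrow> 'a set set \<Rightarrow> bool" where
  "chain_complete \<kappa> Q \<longleftrightarrow>
     (\<forall>X. (\<forall>\<alpha>\<in>Field \<kappa>. X \<alpha> \<in> Q) \<and> (\<forall>\<alpha> \<beta>. (\<alpha>, \<beta>) \<in> \<kappa> \<longrightarrow> X \<beta> \<subseteq> X \<alpha>)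
        \<longrightarrow> (\<Inter>\<alpha>\<in>Field \<kappa>. X \<alpha>) \<in> Q)"

definition dual :: "'a set \<Rightarrow> 'a set set \<Rightarrow> 'a set set" where
  "dual D Q = {A. A \<subseteq> D \<and> D - A \<notin> Q}"

definition iteration :: "'a set \<Rightarrow> 'a set set \<Rightarrow> 'a set set \<Rightarrow> 'a rel set" where
  "iteration D P Q = {R. R \<subseteq> D \<times> D \<and> {x \<in> D. R `` {x} \<in> Q} \<in> P}"

definition dominates :: "'a set \<Rightarrow> 'a set set \<Rightarrow> 'a set set \<Rightarrow> bool" where
  "dominates D P Q \<longleftrightarrow>
     (\<forall>R. R \<subseteq> D \<times> D \<longrightarrow> R \<in> iteration D P Q \<longrightarrow> R\<inverse> \<in> iteration D Q P)"

end

theory Submission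
  imports Defs
begin

text \<open>
  Members of \<open>P\<^sup>d\<close> are the complements of sets outside \<open>P\<close>. So if \<open>P\<^sup>d\<close> is not a
  filter, some \<open>S \<in> P\<close> is the union of two pieces outside \<open>P\<close>, and if \<open>P\<^sup>d\<close> is not
  \<open>\<kappa>\<close>-chain-complete, some \<open>S \<in> P\<close> is the union of an ascending \<open>\<kappa>\<close>-chain of sets outside
  \<open>P\<close>. Suppose that \<open>Q\<close> fails the corresponding closure property as well, say at a family
  \<open>Z\<close> of members of \<open>Q\<close> with \<open>\<Inter>Z \<notin> Q\<close>. Attach to each point \<open>x\<close> of \<open>S\<close> the member of
  \<open>Z\<close> whose index is that of the piece in which \<open>x\<close> first appears, and read this attachment as
  a relation \<open>R \<subseteq> D\<^sup>2\<close>. Every \<open>x \<in> S\<close> has \<open>R\<^sub>x \<in> Q\<close>, so \<open>R \<in> P \<cdot> Q\<close>. A point \<open>y\<close>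
  that lies in all of \<open>Z\<close> is related to all of \<open>S\<close>; a point \<open>y\<close> that misses some member of
  \<open>Z\<close> is related only to points of a single piece (in the chain case since \<open>y\<close> then misses all later
  members too), and that piece is not in \<open>P\<close>. Hence \<open>{y. (R\<inverse>)\<^sub>y \<in> P}\<close> is exactly
  \<open>\<Inter>Z\<close>, and domination would put it in \<open>Q\<close>.

  Domination is extracted once, for such an attachment, in \<open>dominates_family\<close>; the two
  parts of the theorem are its instances \<open>dominates_binary_closure\<close> and
  \<open>dominates_chain_closure\<close>.
\<close>

lemma upward_monotoneD:
  "upward_monotone D Q \<Longrightarrow> A \<in> Q \<Longrightarrow> A \<subseteq> B \<Longrightarrow> B \<subseteq> D \<Longrightarrow> B \<in> Q"
  unfolding upward_monotone_def by blast

lemma dual_iff: "A \<in> dual D P \<longleftrightarrow> A \<subseteq> D \<and> D - A \<notin> P"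
  by (simp add: dual_def)

lemma quantifier_on_dual: "quantifier_on D (dual D P)"
  by (auto simp: quantifier_on_def dual_def)

lemma upward_monotone_dual:
  assumes "upward_monotone D P"
  shows "upward_monotone D (dual D P)"
  unfolding upward_monotone_def dual_iff
proof (intro allI impI, elim conjE, intro conjI notI)
  fix A B
  assume "D - A \<notin> P" "A \<subseteq> B" "D - B \<in> P"
  then show False
    using upward_monotoneD[OF assms, of "D - B" "D - A"] by blast
qed

lemma proper_quantifier_dual:
  "proper_quantifier D P \<Longrightarrow> proper_quantifier D (dual D P)"
  by (simp add: proper_quantifier_def dual_def)

lemma filter_quantifierI_binary:
  assumes "quantifier_on D Q" "upward_monotone D Q" "proper_quantifier D Q"
    and inter: "\<And>A B. A \<in> Q \<Longrightarrow> B \<in> Q \<Longrightarrow> A \<inter> B \<in> Q"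
  shows "filter_quantifier D Q"
proof -
  have "\<Inter>F \<in> Q" if "finite F" "F \<noteq> {}" "F \<subseteq> Q" for F
    using that by (induction F rule: finite_ne_induct) (auto intro: inter)
  then show ?thesis
    using assms(1-3) unfolding filter_quantifier_def by blast
qed

text \<open>
  Domination read for families rather than relations: a \<open>P\<close>-large set \<open>S\<close> of members
  \<open>Z x\<close> of \<open>Q\<close> is the relation \<open>{(x, y). x \<in> S \<and> y \<in> Z x}\<close>, whose converse has the
  sections \<open>{x \<in> S. y \<in> Z x}\<close>.
\<close>

lemma dominates_family:
  assumes P: "quantifier_on D P" "upward_monotone D P"
    and Q: "quantifier_on D Q"
    and dom: "dominates D P Q"
    and S: "S \<in> P" and Z: "\<And>x. x \<in> S \<Longrightarrow> Z x \<in> Q"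
  shows "{y \<in> D. {x \<in> S. y \<in> Z x} \<in> P} \<in> Q"
proof -
  let ?R = "Sigma S Z"
  have SD: "S \<subseteq> D"
    using P(1) S by (auto simp: quantifier_on_def)
  have R: "?R \<subseteq> D \<times> D"
    using SD Z Q by (fastforce simp: quantifier_on_def)
  have "S \<subseteq> {x \<in> D. ?R `` {x} \<in> Q}"
  proof
    fix x assume x: "x \<in> S"
    then have "?R `` {x} = Z x" by auto
    with x Z SD show "x \<in> {x \<in> D. ?R `` {x} \<in> Q}" by auto
  qed
  then have "{x \<in> D. ?R `` {x} \<in> Q} \<in> P"
    using upward_monotoneD[OF P(2) S] by blast
  then have "?R\<inverse> \<in> iteration D Q P"
    using dom R by (simp add: dominates_def iteration_def)
  moreover have "?R\<inverse> `` {y} = {x \<in> S. y \<in> Z x}" for y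
    by auto
  ultimately show ?thesis
    by (simp add: iteration_def)
qed

text \<open>
  The union of two sets outside \<open>P\<close> carries \<open>U\<close> on the points of the first and \<open>V\<close> on the
  remaining ones. A point \<open>y\<close> outside \<open>V\<close> sees at most the first set, and a point outside
  \<open>U\<close> at most the second.
\<close>

lemma dominates_binary_closure:
  assumes P: "quantifier_on D P" "upward_monotone D P"
    and Q: "quantifier_on D Q" "upward_monotone D Q"
    and dom: "dominates D P Q"
    and A: "A \<in> dual D P" and B: "B \<in> dual D P" and AB: "A \<inter> B \<notin> dual D P"
    and U: "U \<in> Q" and V: "V \<in> Q"
  shows "U \<inter> V \<in> Q"
proof -
  let ?S = "D - A \<inter> B"
  let ?Z = "\<lambda>x. if x \<in> A then V else U"
  have S: "?S \<in> P" and nA: "D - A \<notin> P" and nB: "D - B \<notin> P"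
    using A B AB by (auto simp: dual_iff)
  have UD: "U \<subseteq> D"
    using Q(1) U by (auto simp: quantifier_on_def)
  have "y \<in> U \<inter> V" if y: "{x \<in> ?S. y \<in> ?Z x} \<in> P" for y
  proof (rule ccontr)
    assume "y \<notin> U \<inter> V"
    then consider "y \<notin> V" | "y \<notin> U" by blast
    then show False
    proof cases
      case 1
      then have "{x \<in> ?S. y \<in> ?Z x} \<subseteq> D - A" by auto
      with y nA show False
        using upward_monotoneD[OF P(2)] by blast
    next
      case 2
      then have "{x \<in> ?S. y \<in> ?Z x} \<subseteq> D - B" by (auto split: if_splits)
      with y nB show False
        using upward_monotoneD[OF P(2)] by blast
    qed
  qed
  then have "{y \<in> D. {x \<in> ?S. y \<in> ?Z x} \<in> P} \<subseteq> U \<inter> V" by blast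
  moreover have "{y \<in> D. {x \<in> ?S. y \<in> ?Z x} \<in> P} \<in> Q"
    using dominates_family[OF P Q(1) dom S] U V by simp
  ultimately show ?thesis
    using upward_monotoneD[OF Q(2)] UD by blast
qed

text \<open>
  Here \<open>x\<close> carries \<open>Z (i x)\<close> for the least index \<open>i x\<close> with \<open>x \<notin> X (i x)\<close>. If
  \<open>y \<notin> Z \<beta>\<close>, then \<open>y\<close> belongs to \<open>Z (i x)\<close> only for \<open>i x < \<beta>\<close>, and all such \<open>x\<close> lie
  in the complement of \<open>X \<beta>\<close>, which is not in \<open>P\<close>.
\<close>

lemma dominates_chain_closure:
  fixes \<kappa> :: "'k rel" and X Z :: "'k \<Rightarrow> 'a set"
  assumes P: "quantifier_on D P" "upward_monotone D P"
    and Q: "quantifier_on D Q" "upward_monotone D Q"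
    and dom: "dominates D P Q"
    and wo: "Well_order \<kappa>" and ne: "Field \<kappa> \<noteq> {}"
    and X: "\<And>\<alpha>. \<alpha> \<in> Field \<kappa> \<Longrightarrow> X \<alpha> \<in> dual D P"
    and X_desc: "\<And>\<alpha> \<beta>. (\<alpha>, \<beta>) \<in> \<kappa> \<Longrightarrow> X \<beta> \<subseteq> X \<alpha>"
    and X_Inter: "(\<Inter>\<alpha>\<in>Field \<kappa>. X \<alpha>) \<notin> dual D P"
    and Z: "\<And>\<alpha>. \<alpha> \<in> Field \<kappa> \<Longrightarrow> Z \<alpha> \<in> Q"
    and Z_desc: "\<And>\<alpha> \<beta>. (\<alpha>, \<beta>) \<in> \<kappa> \<Longrightarrow> Z \<beta> \<subseteq> Z \<alpha>"
  shows "(\<Inter>\<alpha>\<in>Field \<kappa>. Z \<alpha>) \<in> Q"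
proof -
  interpret wo_rel \<kappa>
    using wo by (simp add: wo_rel_def)
  let ?S = "D - (\<Inter>\<alpha>\<in>Field \<kappa>. X \<alpha>)"
  define i where "i x = minim {\<alpha> \<in> Field \<kappa>. x \<notin> X \<alpha>}" for x
  have i_in: "i x \<in> Field \<kappa>" "x \<notin> X (i x)" if "x \<in> ?S" for x
    using minim_in[of "{\<alpha> \<in> Field \<kappa>. x \<notin> X \<alpha>}"] that unfolding i_def by auto
  have "(\<Inter>\<alpha>\<in>Field \<kappa>. X \<alpha>) \<subseteq> D"
    using X ne by (fastforce simp: dual_iff)
  with X_Inter have S: "?S \<in> P"
    by (simp add: dual_iff)
  have ZD: "(\<Inter>\<alpha>\<in>Field \<kappa>. Z \<alpha>) \<subseteq> D"
    using Z Q(1) ne by (fastforce simp: quantifier_on_def)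
  have "y \<in> Z \<beta>" if y: "{x \<in> ?S. y \<in> Z (i x)} \<in> P" and \<beta>: "\<beta> \<in> Field \<kappa>" for y \<beta>
  proof (rule ccontr)
    assume y\<beta>: "y \<notin> Z \<beta>"
    have "{x \<in> ?S. y \<in> Z (i x)} \<subseteq> D - X \<beta>"
    proof
      fix x assume "x \<in> {x \<in> ?S. y \<in> Z (i x)}"
      then have x: "x \<in> ?S" and yi: "y \<in> Z (i x)" by auto
      have "(\<beta>, i x) \<notin> \<kappa>"
        using Z_desc yi y\<beta> by blast
      then have "(i x, \<beta>) \<in> \<kappa>"
        using TOTALS \<beta> i_in(1)[OF x] by blast
      then show "x \<in> D - X \<beta>"
        using X_desc i_in(2)[OF x] x by blast
    qed
    moreover have "D - X \<beta> \<notin> P"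
      using X[OF \<beta>] by (simp add: dual_iff)
    ultimately show False
      using upward_monotoneD[OF P(2) y] by blast
  qed
  then have "{y \<in> D. {x \<in> ?S. y \<in> Z (i x)} \<in> P} \<subseteq> (\<Inter>\<alpha>\<in>Field \<kappa>. Z \<alpha>)"
    by blast
  moreover have "{y \<in> D. {x \<in> ?S. y \<in> Z (i x)} \<in> P} \<in> Q"
    by (rule dominates_family[OF P Q(1) dom S]) (rule Z[OF i_in(1)])
  ultimately show ?thesis
    using upward_monotoneD[OF Q(2)] ZD by blast
qed

theorem theorem5p1:
  fixes D :: "'a set" and P Q :: "'a set set"
  assumes "D \<noteq> {}"
    and "quantifier_on D P" and "upward_monotone D P" and "proper_quantifier D P"
    and "quantifier_on D Q" and "upward_monotone D Q" and "proper_quantifier D Q"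
    and "dominates D P Q"
  shows "(filter_quantifier D (dual D P) \<or> filter_quantifier D Q) \<and>
    (\<forall>\<kappa> :: 'k rel. Cinfinite \<kappa> \<and> regularCard \<kappa> \<longrightarrow>
       chain_complete \<kappa> (dual D P) \<or> chain_complete \<kappa> Q)"
proof (intro conjI allI impI)
  show "filter_quantifier D (dual D P) \<or> filter_quantifier D Q"
  proof (rule disjCI)
    assume "\<not> filter_quantifier D Q"
    then obtain U V where "U \<in> Q" "V \<in> Q" "U \<inter> V \<notin> Q"
      using filter_quantifierI_binary[OF assms(5-7)] by blast
    then have "A \<inter> B \<in> dual D P" if "A \<in> dual D P" "B \<in> dual D P" for A B
      using dominates_binary_closure[OF assms(2,3,5,6,8) that] by blast
    then show "filter_quantifier D (dual D P)"
      by (intro filter_quantifierI_binary quantifier_on_dual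
          upward_monotone_dual proper_quantifier_dual assms)
  qed
next
  fix \<kappa> :: "'k rel"
  assume \<kappa>: "Cinfinite \<kappa> \<and> regularCard \<kappa>"
  then have wo: "Well_order \<kappa>"
    by (simp add: card_order_on_well_order_on)
  have ne: "Field \<kappa> \<noteq> {}"
    using \<kappa> by (auto simp: cinfinite_def)
  show "chain_complete \<kappa> (dual D P) \<or> chain_complete \<kappa> Q"
  proof (cases "chain_complete \<kappa> (dual D P)")
    case False
    then obtain X where
        X: "\<And>\<alpha>. \<alpha> \<in> Field \<kappa> \<Longrightarrow> X \<alpha> \<in> dual D P"
      and X_desc: "\<And>\<alpha> \<beta>. (\<alpha>, \<beta>) \<in> \<kappa> \<Longrightarrow> X \<beta> \<subseteq> X \<alpha>"
      and X_Inter: "(\<Inter>\<alpha>\<in>Field \<kappa>. X \<alpha>) \<notin> dual D P"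
      unfolding chain_complete_def by auto
    have "chain_complete \<kappa> Q"
      unfolding chain_complete_def
      using dominates_chain_closure[OF assms(2,3,5,6,8) wo ne X X_desc X_Inter]
      by simp
    then show ?thesis ..
  qed simp
qed

end
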